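(* Let $C_1$ and $C_2$ be nonempty closed sets in a finite-dimensional Hilbert space $H$, let $x_0\in C_1$, and let $(x_i)_{i\ge 0}$, $(\hat{x}_i)_{i\ge 0}$ be successive projections between $C_1$ and $C_2$, that is, $$\hat{x}_i=P_{C_2}(x_i),\qquad x_{i+1}=P_{C_1}(\hat{x}_i)\qquad (i\ge 0).$$ If $C_1$ is compact and $P_{C_2}$ is a continuous operation, then there exists $x\in C_1$ such that, with $\hat{x}=P_{C_2}(x)\in C_2$, $$\|x-\hat{x}\|=\lim_{i\to\infty}\|x_i-\hat{x}_i\|.$$
   Context: For a nonempty closed set $C\subseteq H$ and $y\in H$, a projection of $y$ onto $C$ is a point of $C$ at minimal distance from $y$; $P_C$ denotes a map sending each point to a projection of it onto $C$ (a choice among nearest points when they are not unique). *)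

theory Defs
  imports "HOL-Analysis.Analysis"
begin

definition is_projection :: "'a::metric_space set \<Rightarrow> 'a \<Rightarrow> 'a \<Rightarrow> bool" where
  "is_projection C y p \<longleftrightarrow> p \<in> C \<and> (\<forall>z\<in>C. dist y p \<le> dist y z)"

text \<open>Nearest points need not be unique, so projection maps are captured by a predicate:
  \<open>P\<close> is any selection of nearest points. The constant \<^const>\<open>closest_point\<close> is one
  particular such selection.\<close>

definition projection_map :: "'a::metric_space set \<Rightarrow> ('a \<Rightarrow> 'a) \<Rightarrow> bool" where
  "projection_map C P \<longleftrightarrow> (\<forall>y. is_projection C y (P y))"

definition successive_projections ::
  "('a \<Rightarrow> 'a) \<Rightarrow> ('a \<Rightarrow> 'a) \<Rightarrow> (nat \<Rightarrow> 'a) \<Rightarrow> (nat \<Rightarrow> 'a) \<Rightarrow> bool" where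
  "successive_projections P1 P2 x xh \<longleftrightarrow> (\<forall>i. xh i = P2 (x i) \<and> x (Suc i) = P1 (xh i))"

end

(* Each projection step can only shorten the current gap, so the gaps ||x_i - xh_i|| decrease
   to a limit; continuity of P2 identifies it with the gap at any cluster point of (x_i). *)
theory Submission
  imports Defs
begin

text \<open>By \<open>successive_projections_dist_decreasing\<close>, the gaps between
  \<open>x i\<close> and \<open>xh i\<close> decrease; being bounded below by 0, they converge to
  some \<open>L\<close>. Compactness of \<open>C1\<close> gives a subsequence of \<open>x\<close>
  converging to some \<open>a\<close> in \<open>C1\<close>, and continuity of \<open>P2\<close>
  carries this over to \<open>xh\<close>, so the gaps along the subsequence tend to the gap at
  \<open>a\<close>, which must therefore be \<open>L\<close>.\<close>

lemma successive_projections_dist_decreasing: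
  assumes "projection_map C1 P1" and "projection_map C2 P2"
    and "x 0 \<in> C1" and "successive_projections P1 P2 x xh"
  shows "x i \<in> C1" and "xh i \<in> C2" and "dist (x (Suc i)) (xh (Suc i)) \<le> dist (x i) (xh i)"
proof -
  have P1: "P1 y \<in> C1" "z \<in> C1 \<Longrightarrow> dist y (P1 y) \<le> dist y z" for y z
    using assms(1) by (auto simp: projection_map_def is_projection_def)
  have P2: "P2 y \<in> C2" "z \<in> C2 \<Longrightarrow> dist y (P2 y) \<le> dist y z" for y z
    using assms(2) by (auto simp: projection_map_def is_projection_def)
  have step: "xh j = P2 (x j)" "x (Suc j) = P1 (xh j)" for j
    using assms(4) by (auto simp: successive_projections_def)
  show x: "x i \<in> C1"
    using assms(3) by (cases i) (simp_all add: step P1)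
  show xh: "xh i \<in> C2"
    by (simp add: step P2)
  \<comment> \<open>The old point \<open>xh i\<close> lies in \<open>C2\<close>, so it competes with
    the nearest point \<open>xh (Suc i)\<close>.\<close>
  have "dist (x (Suc i)) (xh (Suc i)) \<le> dist (x (Suc i)) (xh i)"
    unfolding step(1)[of "Suc i"] using xh by (rule P2)
  also have "\<dots> = dist (xh i) (P1 (xh i))"
    by (simp add: step(2) dist_commute)
  \<comment> \<open>Likewise \<open>x i\<close> competes with \<open>P1 (xh i)\<close> in
    \<open>C1\<close>; for \<open>i = 0\<close> this rests on the starting point lying in
    \<open>C1\<close>.\<close>
  also have "\<dots> \<le> dist (xh i) (x i)"
    using x by (rule P1)
  finally show "dist (x (Suc i)) (xh (Suc i)) \<le> dist (x i) (xh i)"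
    by (simp add: dist_commute)
qed

theorem theorem3p7:
  fixes C1 C2 :: "'a::{real_inner, complete_space} set"
    and P1 P2 :: "'a \<Rightarrow> 'a"
    and x xh :: "nat \<Rightarrow> 'a"
  assumes "\<exists>B::'a set. finite B \<and> span B = UNIV"
    and "C1 \<noteq> {}" and "closed C1"
    and "C2 \<noteq> {}" and "closed C2"
    and "projection_map C1 P1" and "projection_map C2 P2"
    and "x 0 \<in> C1"
    and "successive_projections P1 P2 x xh"
    and "compact C1"
    and "continuous_on UNIV P2"
  shows "\<exists>a\<in>C1. \<exists>b\<in>C2. b = P2 a \<and> (\<lambda>i. norm (x i - xh i)) \<longlonglongrightarrow> norm (a - b)"
proof -
  note sp = successive_projections_dist_decreasing[OF assms(6-9)]
  have "decseq (\<lambda>i. norm (x i - xh i))"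
    using sp(3) by (intro decseq_SucI) (simp add: dist_norm)
  then obtain L where L: "(\<lambda>i. norm (x i - xh i)) \<longlonglongrightarrow> L"
    using decseq_convergent[of _ 0] by (metis norm_ge_zero)
  obtain a r where a: "a \<in> C1" and r: "strict_mono (r :: nat \<Rightarrow> nat)" and lim: "(x \<circ> r) \<longlonglongrightarrow> a"
    using \<open>compact C1\<close> sp(1) unfolding compact_def by meson
  have xh: "xh = P2 \<circ> x"
    using assms(9) by (auto simp: successive_projections_def)
  have "isCont P2 a"
    using assms(11) by (simp add: continuous_on_eq_continuous_at)
  \<comment> \<open>Continuity makes the nearest points in \<open>C2\<close> follow the subsequence
    to the chosen nearest point of \<open>a\<close>.\<close>
  from isCont_tendsto_compose[OF this lim]
  have "(xh \<circ> r) \<longlonglongrightarrow> P2 a"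
    by (simp add: xh comp_def)
  with lim have "(\<lambda>n. norm ((x \<circ> r) n - (xh \<circ> r) n)) \<longlonglongrightarrow> norm (a - P2 a)"
    by (intro tendsto_intros)
  \<comment> \<open>Monotonicity already gave the limit of the full gap sequence, so one subsequence
    suffices to compute \<open>L\<close>.\<close>
  moreover have "(\<lambda>n. norm ((x \<circ> r) n - (xh \<circ> r) n)) \<longlonglongrightarrow> L"
    using LIMSEQ_subseq_LIMSEQ[OF L r] by (simp add: comp_def)
  ultimately have "L = norm (a - P2 a)"
    by (rule LIMSEQ_unique[rotated])
  moreover have "P2 a \<in> C2"
    using assms(7) by (auto simp: projection_map_def is_projection_def)
  ultimately show ?thesis
    using a L by blast
qed

end
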